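(* Let $G$ and $H$ be graphs on $n$ vertices with connected components $G=G_1\cup\cdots\cup G_r$ and $H=H_1\cup\cdots\cup H_s$, and let $d=\max\{\mathrm{diam}(G_i),\mathrm{diam}(H_j)\}$ be the maximum diameter of the connected components. Suppose there is an invertible matrix $S\in\mathbb{C}^{n\times n}$ and $d$ distinct non-zero values of $q$ such that $\mathcal{D}_q^G S = S\mathcal{D}_q^H$ for each of these values of $q$. Then $G$ and $H$ are cospectral for the generalized distance matrix, i.e., $\mathcal{D}_f^G S = S\mathcal{D}_f^H$ (so $\mathcal{D}_f^G$ and $\mathcal{D}_f^H$ have the same spectrum) for every function $f$.
   Context: $\mathrm{dist}(u,v)$ is the length of a shortest path between $u$ and $v$; the diameter of a connected graph is its largest distance. The exponential distance matrix $\mathcal{D}_q^G$ has $(u,v)$ entry $q^{\mathrm{dist}(u,v)}$ (so diagonal entries are $1$); the generalized distance matrix $\mathcal{D}_f^G$ has $(u,v)$ entry $f(\mathrm{dist}(u,v))$. For vertices in different components the distance is $\infty$, and the corresponding entries are taken to be $0$ (i.e., $q^{\infty}=0$ and $f(\infty)=0$). Two graphs are cospectral for a matrix representation if their matrices have the same multiset of eigenvalues. *)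

theory Defs
  imports "Graph_Theory.Graph_Theory" "Jordan_Normal_Form.Char_Poly"
begin

text \<open>
  Finite simple graphs are the symmetric, loop-free digraphs without multi-arcs of the locale
  \<open>graph\<close>. In such a graph the strongly connected components (\<open>pre_digraph.sccs\<close>, which are
  induced subgraphs) are exactly the connected components.
\<close>

text \<open>The infimum over the empty set is \<open>\<infinity>\<close>, the distance between different components.\<close>

definition graph_dist :: "('a, 'b) pre_digraph \<Rightarrow> 'a \<Rightarrow> 'a \<Rightarrow> enat" where
  "graph_dist G u v = (INF p \<in> {p. pre_digraph.apath G u p v}. enat (length p))"

definition graph_diam :: "('a, 'b) pre_digraph \<Rightarrow> enat" where
  "graph_diam G = Max {graph_dist G u v | u v. u \<in> verts G \<and> v \<in> verts G}"

text \<open>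
  A matrix of a graph on \<open>n\<close> vertices depends on an enumeration
  \<open>x 0, \<dots>, x (n - 1)\<close> of the vertices.
\<close>

definition gen_dist_mat ::
    "nat \<Rightarrow> ('a, 'b) pre_digraph \<Rightarrow> (nat \<Rightarrow> 'a) \<Rightarrow> (nat \<Rightarrow> complex) \<Rightarrow> complex mat" where
  "gen_dist_mat n G x f =
     mat n n (\<lambda>(i, j). case graph_dist G (x i) (x j) of enat k \<Rightarrow> f k | \<infinity> \<Rightarrow> 0)"

definition exp_dist_mat ::
    "nat \<Rightarrow> ('a, 'b) pre_digraph \<Rightarrow> (nat \<Rightarrow> 'a) \<Rightarrow> complex \<Rightarrow> complex mat" where
  "exp_dist_mat n G x q =
     mat n n (\<lambda>(i, j). case graph_dist G (x i) (x j) of enat k \<Rightarrow> q ^ k | \<infinity> \<Rightarrow> 0)"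

text \<open>Eigenvalues are counted with algebraic multiplicity.\<close>

definition eigenvalue_mset :: "complex mat \<Rightarrow> complex multiset" where
  "eigenvalue_mset A = proots (char_poly A)"

definition cospectral :: "complex mat \<Rightarrow> complex mat \<Rightarrow> bool" where
  "cospectral A B \<longleftrightarrow> eigenvalue_mset A = eigenvalue_mset B"

end

theory Submission
  imports Defs
begin

text \<open>
  The matrix \<open>D\<^sub>f\<close> is linear in \<open>f\<close> and depends only on the values of \<open>f\<close> at the distances
  \<open>0, \<dots>, d\<close> that occur. Since \<open>D\<^sub>q\<close> is the identity for \<open>q = 0\<close>, the matrix \<open>S\<close> intertwines
  the exponential distance matrices for \<open>d + 1\<close> values of \<open>q\<close>. The Vandermonde matrix of these
  values is invertible, so every \<open>f\<close> agrees on \<open>0, \<dots>, d\<close> with a linear combination of the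
  functions \<open>k \<mapsto> q ^ k\<close>, and \<open>S\<close> intertwines \<open>D\<^sub>f\<^sup>G\<close> and \<open>D\<^sub>f\<^sup>H\<close> as well.
\<close>

lemma ex_sum_powers_eq:
  fixes f :: "nat \<Rightarrow> 'a :: field"
  assumes "finite Q"
  shows "\<exists>a. \<forall>k < card Q. (\<Sum>q\<in>Q. a q * q ^ k) = f k"
  using assms
proof (induction Q arbitrary: f)
  case empty
  show ?case
    by simp
next
  case (insert r Q)
  \<comment> \<open>The operator \<open>g \<mapsto> (\<lambda>k. g (Suc k) - r * g k)\<close> kills the powers of \<open>r\<close> and multiplies
    those of \<open>q\<close> by \<open>q - r\<close>.\<close>
  from insert.IH[of "\<lambda>k. f (Suc k) - r * f k"] obtain b where
    b: "\<And>k. k < card Q \<Longrightarrow> (\<Sum>q\<in>Q. b q * q ^ k) = f (Suc k) - r * f k"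
    by auto
  define a where "a q = b q / (q - r)" for q
  define c where "c = f 0 - (\<Sum>q\<in>Q. a q)"
  define s where "s k = c * r ^ k + (\<Sum>q\<in>Q. a q * q ^ k)" for k
  have b_eq: "b q = a q * (q - r)" if "q \<in> Q" for q
    using that insert.hyps by (auto simp: a_def)
  have s_Suc: "s (Suc k) = r * s k + (\<Sum>q\<in>Q. b q * q ^ k)" for k
    by (simp add: s_def b_eq algebra_simps sum_distrib_left flip: sum.distrib)
  have "s k = f k" if "k \<le> card Q" for k
    using that
  proof (induction k)
    case 0
    show ?case
      by (simp add: s_def c_def)
  next
    case (Suc k)
    then show ?case
      by (simp add: s_Suc b)
  qed
  moreover have "(\<Sum>q\<in>insert r Q. (a(r := c)) q * q ^ k) = s k" for k
    using insert.hyps by (auto simp: s_def intro!: sum.cong)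
  ultimately show ?case
    using insert.hyps by (metis card_insert_disjoint less_Suc_eq_le)
qed

lemma intertwining_imp_similar_mat:
  fixes A B S :: "'a :: semiring_1 mat"
  assumes A: "A \<in> carrier_mat n n" and B: "B \<in> carrier_mat n n" and S: "S \<in> carrier_mat n n"
    and "invertible_mat S" and AS: "A * S = S * B"
  shows "similar_mat A B"
proof -
  obtain T where ST: "S * T = 1\<^sub>m n" and TS: "T * S = 1\<^sub>m (dim_row T)"
    using S \<open>invertible_mat S\<close> by (auto simp: invertible_mat_def inverts_mat_def)
  have "dim_col T = n" "dim_row T = n"
    using arg_cong[OF ST, of dim_col] arg_cong[OF TS, of dim_col] S by auto
  then have T: "T \<in> carrier_mat n n"
    by auto
  have "A = A * S * T"
    using A S T ST by simp
  also have "\<dots> = S * B * T"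
    by (simp only: AS)
  finally show ?thesis
    using A B S T ST TS by (intro similar_matI[of _ _ S T n]) auto
qed

lemma similar_mat_imp_cospectral: "similar_mat A B \<Longrightarrow> cospectral A B"
  by (simp add: cospectral_def eigenvalue_mset_def char_poly_similar)

lemma graph_dist_le_length:
  assumes "pre_digraph.apath G u p v"
  shows "graph_dist G u v \<le> enat (length p)"
  using assms unfolding graph_dist_def by (intro INF_lower) simp

lemma graph_dist_attained:
  assumes "graph_dist G u v = enat k"
  obtains p where "pre_digraph.apath G u p v" "length p = k"
proof -
  let ?L = "(\<lambda>p. enat (length p)) ` {p. pre_digraph.apath G u p v}"
  have "?L \<noteq> {}"
    using assms by (metis Inf_empty graph_dist_def enat.distinct(1) top_enat_def)
  then have "Inf ?L \<in> ?L"
    by (meson ex_in_conv wellorder_InfI)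
  then show thesis
    using assms that by (auto simp: graph_dist_def)
qed

lemma (in wf_digraph) graph_dist_eq_0_iff:
  assumes "u \<in> verts G"
  shows "graph_dist G u v = 0 \<longleftrightarrow> u = v"
proof
  assume "graph_dist G u v = 0"
  then obtain p where "apath u p v" "length p = 0"
    unfolding zero_enat_def by (rule graph_dist_attained)
  then show "u = v"
    by (simp add: apath_Nil_iff)
next
  assume "u = v"
  then have "apath u [] v"
    using assms by (simp add: apath_Nil_iff)
  then show "graph_dist G u v = 0"
    using graph_dist_le_length by (fastforce simp flip: zero_enat_def)
qed

lemma (in wf_digraph) graph_dist_le_subgraph:
  assumes "subgraph C G"
  shows "graph_dist G u v \<le> graph_dist C u v"
  unfolding graph_dist_def
  using assms by (intro INF_superset_mono) (auto intro: subgraph_apath_imp_apath)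

lemma (in wf_digraph) graph_dist_eq_infinity_iff: "graph_dist G u v = \<infinity> \<longleftrightarrow> \<not> u \<rightarrow>\<^sup>* v"
proof
  assume "graph_dist G u v = \<infinity>"
  then have "\<not> apath u p v" for p
    using graph_dist_le_length[of G u p v] by auto
  then show "\<not> u \<rightarrow>\<^sup>* v"
    by (simp add: reachable_apath)
next
  assume "\<not> u \<rightarrow>\<^sup>* v"
  then have "{p. apath u p v} = {}"
    by (simp add: reachable_apath)
  then show "graph_dist G u v = \<infinity>"
    by (simp add: graph_dist_def top_enat_def)
qed

lemma graph_dist_le_graph_diam:
  assumes "finite (verts G)" "u \<in> verts G" "v \<in> verts G"
  shows "graph_dist G u v \<le> graph_diam G"
  unfolding graph_diam_def using assms by (intro Max_ge finite_image_set2) auto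

lemma (in pseudo_graph) graph_dist_le_scc_diam:
  assumes "u \<in> verts G" and "graph_dist G u v \<noteq> \<infinity>"
  obtains C where "C \<in> sccs" "graph_dist G u v \<le> graph_diam C"
proof
  let ?C = "G \<restriction> {w. u \<rightarrow>\<^sup>* w}"
  show "?C \<in> sccs"
    using assms(1) by (rule induce_reachable_is_in_sccs)
  then have sub: "subgraph ?C G"
    using in_sccs_imp_induced induced_imp_subgraph by blast
  then have "finite (verts ?C)"
    by (intro finite_subset[OF _ finite_verts]) (simp add: subgraph_def)
  moreover have "u \<rightarrow>\<^sup>* v"
    using assms(2) by (simp add: graph_dist_eq_infinity_iff)
  ultimately have "graph_dist ?C u v \<le> graph_diam ?C"
    using assms(1) by (intro graph_dist_le_graph_diam) auto
  with graph_dist_le_subgraph[OF sub] show "graph_dist G u v \<le> graph_diam ?C"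
    by (rule order_trans)
qed

lemma (in fin_digraph) finite_sccs: "finite sccs"
  unfolding sccs_conv_sccs_verts using finite_sccs_verts by simp

lemma exp_dist_mat_eq_gen_dist_mat: "exp_dist_mat n G x q = gen_dist_mat n G x (\<lambda>k. q ^ k)"
  by (simp add: exp_dist_mat_def gen_dist_mat_def)

lemma gen_dist_mat_carrier [simp]: "gen_dist_mat n G x f \<in> carrier_mat n n"
  by (simp add: gen_dist_mat_def)

lemma gen_dist_mat_zero: "gen_dist_mat n G x (\<lambda>_. 0) = 0\<^sub>m n n"
  by (auto simp: gen_dist_mat_def split: enat.split)

lemma gen_dist_mat_add:
  "gen_dist_mat n G x (\<lambda>k. f k + g k) = gen_dist_mat n G x f + gen_dist_mat n G x g"
  by (auto simp: gen_dist_mat_def split: enat.split)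

lemma gen_dist_mat_smult:
  "gen_dist_mat n G x (\<lambda>k. c * f k) = c \<cdot>\<^sub>m gen_dist_mat n G x f"
  by (auto simp: gen_dist_mat_def split: enat.split)

lemma gen_dist_mat_intertwining_sum:
  assumes S: "S \<in> carrier_mat n n"
    and "\<And>q. q \<in> Q \<Longrightarrow> gen_dist_mat n G x (f q) * S = S * gen_dist_mat n H y (f q)"
  shows "gen_dist_mat n G x (\<lambda>k. \<Sum>q\<in>Q. a q * f q k) * S =
    S * gen_dist_mat n H y (\<lambda>k. \<Sum>q\<in>Q. a q * f q k)"
  using assms(2)
proof (induction Q rule: infinite_finite_induct)
  case (insert q Q)
  then show ?case
    using S
    by (simp add: gen_dist_mat_add gen_dist_mat_smult
        add_mult_distrib_mat[of _ n n _ S n] mult_add_distrib_mat[of S n n _ n]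
        mult_smult_assoc_mat[of _ n n S n] mult_smult_distrib[of S n n _ n])
qed (use S in \<open>simp_all add: gen_dist_mat_zero\<close>)

lemma (in wf_digraph) exp_dist_mat_0:
  assumes "x \<in> {..<n} \<rightarrow> verts G" "inj_on x {..<n}"
  shows "exp_dist_mat n G x 0 = 1\<^sub>m n"
proof (rule eq_matI)
  fix i j assume "i < dim_row (1\<^sub>m n :: complex mat)" "j < dim_col (1\<^sub>m n :: complex mat)"
  then have ij: "i < n" "j < n"
    by simp_all
  then have "graph_dist G (x i) (x j) = 0 \<longleftrightarrow> x i = x j"
    using assms(1) by (intro graph_dist_eq_0_iff) auto
  also have "\<dots> \<longleftrightarrow> i = j"
    using assms(2) ij by (simp add: inj_on_eq_iff)
  finally show "exp_dist_mat n G x 0 $$ (i, j) = 1\<^sub>m n $$ (i, j)"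
    using ij by (auto simp: exp_dist_mat_def zero_enat_def power_0_left split: enat.split)
qed (simp_all add: exp_dist_mat_def)

lemma (in pseudo_graph) gen_dist_mat_cong:
  assumes "x \<in> {..<n} \<rightarrow> verts G" and "\<And>C. C \<in> sccs \<Longrightarrow> graph_diam C \<le> enat d"
    and "\<And>k. k \<le> d \<Longrightarrow> f k = g k"
  shows "gen_dist_mat n G x f = gen_dist_mat n G x g"
proof -
  have "f k = g k" if "i < n" and dist: "graph_dist G (x i) (x j) = enat k" for i j k
  proof -
    have "x i \<in> verts G"
      using assms(1) \<open>i < n\<close> by auto
    with dist obtain C where "C \<in> sccs" "enat k \<le> graph_diam C"
      using graph_dist_le_scc_diam by (metis enat.distinct(1))
    then have "enat k \<le> enat d"
      using assms(2) order_trans by blast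
    then show ?thesis
      using assms(3) by simp
  qed
  then show ?thesis
    by (auto simp: gen_dist_mat_def split: enat.split)
qed

theorem theorem4p1:
  fixes G :: "('a, 'b) pre_digraph" and H :: "('c, 'd) pre_digraph"
    and x :: "nat \<Rightarrow> 'a" and y :: "nat \<Rightarrow> 'c"
    and n d :: nat and S :: "complex mat" and Q :: "complex set"
  assumes "graph G" and "graph H"
    and "bij_betw x {..<n} (verts G)" and "bij_betw y {..<n} (verts H)"
    and "enat d = Max (graph_diam ` pre_digraph.sccs G \<union> graph_diam ` pre_digraph.sccs H)"
    and "S \<in> carrier_mat n n" and "invertible_mat S"
    and "finite Q" and "card Q = d" and "0 \<notin> Q"
    and "\<forall>q \<in> Q. exp_dist_mat n G x q * S = S * exp_dist_mat n H y q"
  shows "\<forall>f :: nat \<Rightarrow> complex.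
    gen_dist_mat n G x f * S = S * gen_dist_mat n H y f \<and>
    cospectral (gen_dist_mat n G x f) (gen_dist_mat n H y f)"
proof (intro allI conjI)
  fix f :: "nat \<Rightarrow> complex"
  interpret G: graph G by fact
  interpret H: graph H by fact
  note x = bij_betw_imp_funcset[OF assms(3)] bij_betw_imp_inj_on[OF assms(3)]
  note y = bij_betw_imp_funcset[OF assms(4)] bij_betw_imp_inj_on[OF assms(4)]
  have diam_G: "\<And>C. C \<in> G.sccs \<Longrightarrow> graph_diam C \<le> enat d"
    and diam_H: "\<And>C. C \<in> H.sccs \<Longrightarrow> graph_diam C \<le> enat d"
    unfolding assms(5) using G.finite_sccs H.finite_sccs by (auto intro!: Max_ge)
  obtain a where a: "\<And>k. k \<le> d \<Longrightarrow> (\<Sum>q\<in>insert 0 Q. a q * q ^ k) = f k"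
    using assms(8-10) ex_sum_powers_eq[of "insert 0 Q" f] by (auto simp: less_Suc_eq_le)
  have "exp_dist_mat n G x q * S = S * exp_dist_mat n H y q" if "q \<in> insert 0 Q" for q
    using that assms(6,11) by (auto simp: G.exp_dist_mat_0[OF x] H.exp_dist_mat_0[OF y])
  then have "gen_dist_mat n G x (\<lambda>k. \<Sum>q\<in>insert 0 Q. a q * q ^ k) * S =
      S * gen_dist_mat n H y (\<lambda>k. \<Sum>q\<in>insert 0 Q. a q * q ^ k)"
    using assms(6) unfolding exp_dist_mat_eq_gen_dist_mat
    by (intro gen_dist_mat_intertwining_sum)
  then show "gen_dist_mat n G x f * S = S * gen_dist_mat n H y f"
    using G.gen_dist_mat_cong[OF x(1) diam_G a] H.gen_dist_mat_cong[OF y(1) diam_H a] by simp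
  then show "cospectral (gen_dist_mat n G x f) (gen_dist_mat n H y f)"
    using assms(6,7) by (intro similar_mat_imp_cospectral intertwining_imp_similar_mat[of _ n]) auto
qed

end
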